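(* Let $n,m,b$ be positive integers, $\rho\ge1$, and let $a_1,\dots,a_b$ be the output of Algorithm Bricks on input $(n,m,b,\rho)$, and suppose $\sum_{j=1}^b a_j\ge n$. Let $a'_1\ge\dots\ge a'_b$ be non-negative integers with $a'_j\le a_j$ for all $j$ and $\sum_j a'_j=n$ (the bag sizes actually used for the $n$ unit jobs). Let $s_1\ge\dots\ge s_m$ be non-negative integers with $\sum_{i=1}^m s_i=n$. Then Algorithm IntegralAssignment on input $(a'_1,\dots,a'_b;\,s_1,\dots,s_m;\,\rho)$ produces an assignment in which, for every machine $i$, the total size of bags assigned to machine $i$ is at most $\rho\, s_i$ (in particular, machines with $s_i=0$ receive only bags of size $0$), i.e., the makespan is at most $\rho$.
   Context: Algorithm Bricks (input: $n,m,b,\rho$): set $c\gets n$; for $j=1,\dots,b$: $z\gets\lceil c/m\rceil$, $a_j\gets\lfloor z\rho\rfloor$, $c\gets c-z$; return $a_1,\dots,a_b$. Algorithm IntegralAssignment (input: bag sizes $a'_1\ge\dots\ge a'_b$, speeds $s_1\ge\dots\ge s_m$, $\rho$): for each machine $i$ set $c_i\gets s_i$ and $M_i\gets\emptyset$; for $k=1,\dots,b$ in this order: choose $i$ with the largest $c_i$, set $M_i\gets M_i\cup\{k\}$ and $c_i\gets c_i-\lceil a'_k/\rho\rceil$; return $M_1,\dots,M_m$. The makespan of the assignment is $\max_i(\sum_{k\in M_i}a'_k)/s_i$. Setting: the $n$ jobs all have processing time $1$, and the speeds are normalized so that the optimal makespan equals $1$ with every machine fully loaded, so that the speeds are integers summing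 to $n$. *)

theory Defs
  imports "HOL-Library.Extended_Real"
begin

text \<open>
  Machines and bags are numbered from 0. Speeds and bag sizes are lists of naturals.
\<close>

text \<open>
  The first argument of \<open>bricks\<close> is the current value of the counter \<open>c\<close>, initially \<open>n\<close>.
  For \<open>m \<ge> 1\<close> we have \<open>z \<le> c\<close>, so the natural-number subtraction does not truncate.
\<close>

fun bricks :: "nat \<Rightarrow> nat \<Rightarrow> nat \<Rightarrow> real \<Rightarrow> nat list" where
  "bricks c m 0 \<rho> = []"
| "bricks c m (Suc b) \<rho> =
     (let z = nat \<lceil>real c / real m\<rceil>
      in nat \<lfloor>real z * \<rho>\<rfloor> # bricks (c - z) m b \<rho>)"

text \<open>
  \<open>assignment_run as ss \<rho> k c M\<close>: after processing the first \<open>k\<close> bags, the algorithm can be in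
  the state with remaining capacities \<open>c\<close> and bag sets \<open>M\<close>. It is a relation because the choice
  among several machines of largest capacity is left open. Capacities are integers since nothing
  in the algorithm itself prevents them from becoming negative.
\<close>

inductive assignment_run ::
  "nat list \<Rightarrow> nat list \<Rightarrow> real \<Rightarrow> nat \<Rightarrow> int list \<Rightarrow> nat set list \<Rightarrow> bool"
  for as :: "nat list" and ss :: "nat list" and \<rho> :: real where
  init: "assignment_run as ss \<rho> 0 (map int ss) (replicate (length ss) {})"
| step: "\<lbrakk>assignment_run as ss \<rho> k c M; k < length as;
          i < length ss; \<forall>j<length ss. c ! j \<le> c ! i\<rbrakk>
         \<Longrightarrow> assignment_run as ss \<rho> (Suc k)
               (c[i := c ! i - \<lceil>real (as ! k) / \<rho>\<rceil>]) (M[i := insert k (M ! i)])"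

definition integral_assignment ::
  "nat list \<Rightarrow> nat list \<Rightarrow> real \<Rightarrow> nat set list \<Rightarrow> bool" where
  "integral_assignment as ss \<rho> M \<longleftrightarrow> (\<exists>c. assignment_run as ss \<rho> (length as) c M)"

definition is_assignment :: "nat \<Rightarrow> nat \<Rightarrow> nat set list \<Rightarrow> bool" where
  "is_assignment b m M \<longleftrightarrow>
     length M = m \<and> (\<forall>i<m. M ! i \<subseteq> {..<b}) \<and> (\<forall>k<b. \<exists>!i. i < m \<and> k \<in> M ! i)"

definition load :: "nat list \<Rightarrow> nat set list \<Rightarrow> nat \<Rightarrow> nat" where
  "load as M i = (\<Sum>k\<in>M ! i. as ! k)"

text \<open>
  The quotient is taken in the extended reals, where \<open>0 / 0 = 0\<close> and \<open>x / 0 = \<infinity>\<close> for \<open>x > 0\<close>: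
  a machine of speed 0 is harmless exactly if its load is 0.
\<close>

definition makespan :: "nat list \<Rightarrow> nat list \<Rightarrow> nat set list \<Rightarrow> ereal" where
  "makespan as ss M =
     (MAX i\<in>{..<length ss}. ereal (real (load as M i)) / ereal (real (ss ! i)))"

end

theory Submission
  imports Defs
begin

text \<open>
  Let \<open>z k\<close> be the value of \<open>z\<close> in the \<open>k\<close>-th round of Bricks and \<open>w k = \<lceil>as ! k / \<rho>\<rceil>\<close> the capacity
  consumed by bag \<open>k\<close>. From \<open>as ! k \<le> \<lfloor>z k * \<rho>\<rfloor>\<close> we get \<open>w k \<le> z k\<close>, so the total remaining capacity
  never drops below the counter of Bricks. By averaging, the largest capacity before bag \<open>k\<close> is at
  least \<open>z k \<ge> w k\<close>, hence no capacity ever becomes negative. Thus the \<open>w\<close>-weight of the bags on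
  machine \<open>i\<close> is at most \<open>ss ! i\<close>, and \<open>as ! k \<le> \<rho> * w k\<close>.
\<close>

text \<open>This is the counter of Bricks before round \<open>k\<close>. Writing it as an iterate
  lets a round be split off at either end: \<open>bricks\<close> recurses from the first round,
  while a run grows by a last one.\<close>

definition bricks_counter :: "nat \<Rightarrow> nat \<Rightarrow> nat \<Rightarrow> nat" where
  "bricks_counter n m k = ((\<lambda>c. c - nat \<lceil>real c / real m\<rceil>) ^^ k) n"

lemma bricks_counter_0 [simp]: "bricks_counter n m 0 = n"
  by (simp add: bricks_counter_def)

lemma bricks_counter_Suc:
  "bricks_counter n m (Suc k) =
     bricks_counter n m k - nat \<lceil>real (bricks_counter n m k) / real m\<rceil>"
  by (simp add: bricks_counter_def)

lemma bricks_nth: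
  "k < b \<Longrightarrow> bricks n m b \<rho> ! k
     = nat \<lfloor>real (nat \<lceil>real (bricks_counter n m k) / real m\<rceil>) * \<rho>\<rfloor>"
proof (induction b arbitrary: n k)
  case (Suc b)
  show ?case
  proof (cases k)
    case (Suc k')
    have "bricks_counter (n - nat \<lceil>real n / real m\<rceil>) m k' = bricks_counter n m (Suc k')"
      by (simp add: bricks_counter_def funpow_Suc_right del: funpow.simps(2))
    then show ?thesis using Suc Suc.IH Suc.prems by (simp add: Let_def)
  qed (simp add: Let_def)
qed simp

lemma sum_nth_list_update:
  fixes xs :: "'a :: ab_group_add list"
  assumes "i < length xs"
  shows "(\<Sum>j<length xs. xs[i := x] ! j) = (\<Sum>j<length xs. xs ! j) - xs ! i + x"
proof -
  have "(\<Sum>j<length xs. xs[i := x] ! j) = x + (\<Sum>j\<in>{..<length xs} - {i}. xs ! j)"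
    using assms by (subst sum.remove[of _ i]) (auto intro!: sum.cong)
  moreover have "(\<Sum>j<length xs. xs ! j) = xs ! i + (\<Sum>j\<in>{..<length xs} - {i}. xs ! j)"
    using assms by (subst sum.remove[of _ i]) auto
  ultimately show ?thesis by simp
qed

text \<open>A finite nonempty set of capacities has a maximum, so the algorithm never gets stuck.
  Without this, a claim about all runs could hold vacuously.\<close>

lemma assignment_run_exists:
  assumes "ss \<noteq> []" "k \<le> length as"
  shows "\<exists>c M. assignment_run as ss \<rho> k c M"
  using assms(2)
proof (induction k)
  case 0
  show ?case by (blast intro: assignment_run.init)
next
  case (Suc k)
  then obtain c M where run: "assignment_run as ss \<rho> k c M" by auto
  let ?C = "(!) c ` {..<length ss}"
  have C: "finite ?C" "?C \<noteq> {}" using assms(1) by auto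
  obtain i where "i < length ss" "c ! i = Max ?C"
    using Max_in[OF C] by auto
  then have "\<forall>j<length ss. c ! j \<le> c ! i" by simp
  with run \<open>i < length ss\<close> Suc.prems show ?case
    by (blast intro: assignment_run.step Suc_le_lessD)
qed

lemma assignment_run_is_assignment:
  "assignment_run as ss \<rho> k c M \<Longrightarrow> is_assignment k (length ss) M"
proof (induction rule: assignment_run.induct)
  case (step k c M i)
  have len: "length M = length ss" and sub: "\<And>j. j < length ss \<Longrightarrow> M ! j \<subseteq> {..<k}"
    and ex1: "\<And>l. l < k \<Longrightarrow> \<exists>!j. j < length ss \<and> l \<in> M ! j"
    using step.IH by (auto simp: is_assignment_def)
  let ?M = "M[i := insert k (M ! i)]"
  have "\<exists>!j. j < length ss \<and> l \<in> ?M ! j" if "l < Suc k" for l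
  proof (cases "l = k")
    case True
    \<comment> \<open>All earlier sets lie in \<open>{..<k}\<close>, so bag \<open>k\<close> occurs
      only where it has just been inserted.\<close>
    have "j < length ss \<and> l \<in> ?M ! j \<longleftrightarrow> j = i" for j
      using sub[of j] step.hyps len True by (auto simp: nth_list_update)
    then show ?thesis by simp
  next
    case False
    then have "j < length ss \<and> l \<in> ?M ! j \<longleftrightarrow> j < length ss \<and> l \<in> M ! j" for j
      using len step.hyps by (auto simp: nth_list_update)
    then show ?thesis using ex1[of l] that False by simp
  qed
  moreover have "?M ! j \<subseteq> {..<Suc k}" if "j < length ss" for j
    using sub[of j] sub[of i] step.hyps len that
    by (cases "j = i") (auto simp: less_Suc_eq dest: subsetD)
  ultimately show ?case using len by (simp add: is_assignment_def)
qed (simp add: is_assignment_def)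

text \<open>Each bag is new when it is placed, so the sum over the chosen set gains exactly the one
  term that is subtracted from the capacity.\<close>

lemma assignment_run_capacity:
  assumes "assignment_run as ss \<rho> k c M"
  shows "length c = length ss \<and>
    (\<forall>j<length ss. c ! j = int (ss ! j) - (\<Sum>l\<in>M ! j. \<lceil>real (as ! l) / \<rho>\<rceil>))"
  using assms
proof (induction rule: assignment_run.induct)
  case (step k c M i)
  have M: "length M = length ss" "M ! i \<subseteq> {..<k}"
    using assignment_run_is_assignment[OF step.hyps(1)] step.hyps
    by (auto simp: is_assignment_def)
  then have "k \<notin> M ! i" "finite (M ! i)"
    by (auto intro: finite_subset)
  with M step show ?case
    by (auto simp: nth_list_update)
qed simp

text \<open>Nonnegativity alone is not inductive; the bound on the total capacity is carried along
  to supply it. The bound is an equality at the start, since Bricks is run on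
  \<open>sum_list ss\<close>.\<close>

lemma assignment_run_capacity_nonneg:
  assumes "assignment_run as ss \<rho> k c M" and "\<rho> > 0" and "ss \<noteq> []"
    and le: "\<forall>j<length as. as ! j \<le> bricks (sum_list ss) (length ss) (length as) \<rho> ! j"
  shows "(\<forall>j<length ss. 0 \<le> c ! j) \<and>
    int (bricks_counter (sum_list ss) (length ss) k) \<le> (\<Sum>j<length ss. c ! j)"
  using assms(1)
proof (induction rule: assignment_run.induct)
  case init
  then show ?case by (simp add: sum_list_sum_nth atLeast0LessThan)
next
  case (step k c M i)
  let ?m = "length ss" and ?w = "\<lceil>real (as ! k) / \<rho>\<rceil>"
  define r where "r = bricks_counter (sum_list ss) ?m k"
  define z where "z = nat \<lceil>real r / real ?m\<rceil>"
  have m: "real ?m \<ge> 1" using \<open>ss \<noteq> []\<close> by (cases ss) auto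
  have len: "length c = ?m" using assignment_run_capacity step.hyps(1) by blast
  have "as ! k \<le> nat \<lfloor>real z * \<rho>\<rfloor>"
    using le step.hyps by (simp add: bricks_nth z_def r_def)
  moreover have "real (nat \<lfloor>real z * \<rho>\<rfloor>) \<le> real z * \<rho>"
    using \<open>\<rho> > 0\<close> by simp
  ultimately have "real (as ! k) \<le> real z * \<rho>" by linarith
  \<comment> \<open>Since \<open>z\<close> is an integer, rounding the quotient up cannot push it
    past \<open>z\<close>.\<close>
  then have wz: "?w \<le> int z"
    using \<open>\<rho> > 0\<close> by (simp add: ceiling_le_iff divide_le_eq)
  \<comment> \<open>The aim is \<open>z \<le> r\<close>, so that the natural-number subtraction in
    the counter does not truncate.\<close>
  have "real r / real ?m \<le> real r"
    using m mult_left_mono[OF m, of "real r"] by (simp add: divide_le_eq)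
  then have zr: "z \<le> r"
    by (simp add: z_def nat_le_iff ceiling_le_iff)
  have "int r \<le> (\<Sum>j<?m. c ! j)" using step.IH by (simp add: r_def)
  also have "\<dots> \<le> (\<Sum>j<?m. c ! i)" using step.hyps by (intro sum_mono) auto
  finally have "int r \<le> c ! i * int ?m" by (simp add: mult.commute)
  then have "real r \<le> of_int (c ! i) * real ?m"
    by (metis of_int_le_iff of_int_mult of_int_of_nat_eq)
  \<comment> \<open>The average \<open>r / m\<close> is at most the integer \<open>c ! i\<close>,
    hence so is its ceiling.\<close>
  then have "int z \<le> c ! i"
    using m \<open>ss \<noteq> []\<close> step.IH step.hyps by (simp add: z_def ceiling_le_iff divide_le_eq)
  with wz have "?w \<le> c ! i" by linarith
  moreover have "int (bricks_counter (sum_list ss) ?m (Suc k)) = int r - int z"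
    using zr by (simp add: bricks_counter_Suc r_def z_def of_nat_diff)
  moreover have "(\<Sum>j<?m. c[i := c ! i - ?w] ! j) = (\<Sum>j<?m. c ! j) - ?w"
    using sum_nth_list_update[of i c "c ! i - ?w"] len step.hyps by simp
  ultimately show ?case
    using step.IH step.hyps len wz by (auto simp: nth_list_update r_def)
qed

lemma load_le_speed:
  assumes "assignment_run as ss \<rho> k c M" and "\<rho> > 0" and "i < length ss" and "0 \<le> c ! i"
  shows "real (load as M i) \<le> \<rho> * real (ss ! i)"
proof -
  have "real (load as M i) = (\<Sum>k\<in>M ! i. \<rho> * (real (as ! k) / \<rho>))"
    using \<open>\<rho> > 0\<close> by (simp add: load_def)
  also have "\<dots> \<le> (\<Sum>k\<in>M ! i. \<rho> * of_int \<lceil>real (as ! k) / \<rho>\<rceil>)"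
    using \<open>\<rho> > 0\<close> by (intro sum_mono mult_left_mono) auto
  also have "\<dots> = \<rho> * of_int (\<Sum>k\<in>M ! i. \<lceil>real (as ! k) / \<rho>\<rceil>)"
    by (simp add: sum_distrib_left)
  also have "(\<Sum>k\<in>M ! i. \<lceil>real (as ! k) / \<rho>\<rceil>) \<le> int (ss ! i)"
    using assignment_run_capacity[OF assms(1)] assms(3,4) by auto
  then have "\<rho> * of_int (\<Sum>k\<in>M ! i. \<lceil>real (as ! k) / \<rho>\<rceil>) \<le> \<rho> * of_int (int (ss ! i))"
    using \<open>\<rho> > 0\<close> by (intro mult_left_mono) (simp_all only: of_int_le_iff less_imp_le)
  finally show ?thesis by simp
qed

text \<open>On a machine of speed 0 the load bound forces load 0, and the extended-real quotient
  \<open>0 / 0 = 0\<close> is at most \<open>\<rho>\<close> because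
  \<open>\<rho> \<ge> 0\<close>.\<close>

lemma makespan_le:
  assumes "ss \<noteq> []" and "\<rho> \<ge> 0"
    and load: "\<And>i. i < length ss \<Longrightarrow> real (load as M i) \<le> \<rho> * real (ss ! i)"
  shows "makespan as ss M \<le> ereal \<rho>"
proof -
  have "ereal (real (load as M i)) / ereal (real (ss ! i)) \<le> ereal \<rho>" if "i < length ss" for i
    using load[OF that] \<open>\<rho> \<ge> 0\<close>
    by (cases "ss ! i = 0") (auto simp: divide_le_eq zero_ereal_def[symmetric])
  moreover have "{..<length ss} \<noteq> {}" using \<open>ss \<noteq> []\<close> by auto
  ultimately show ?thesis
    unfolding makespan_def by (intro Max.boundedI) blast+
qed

theorem theorem15:
  fixes n m b :: nat and \<rho> :: real and as ss :: "nat list"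
  assumes "n > 0" and "m > 0" and "b > 0" and "\<rho> \<ge> 1"
    and "sum_list (bricks n m b \<rho>) \<ge> n"
    and "length as = b" and "sorted_wrt (\<ge>) as"
    and "\<forall>j<b. as ! j \<le> bricks n m b \<rho> ! j"
    and "sum_list as = n"
    and "length ss = m" and "sorted_wrt (\<ge>) ss"
    and "sum_list ss = n"
  shows "(\<exists>M. integral_assignment as ss \<rho> M) \<and>
    (\<forall>M. integral_assignment as ss \<rho> M \<longrightarrow>
       is_assignment b m M \<and>
       (\<forall>i<m. real (load as M i) \<le> \<rho> * real (ss ! i)) \<and>
       (\<forall>i<m. ss ! i = 0 \<longrightarrow> (\<forall>k\<in>M ! i. as ! k = 0)) \<and>
       makespan as ss M \<le> ereal \<rho>)"
proof (intro conjI allI impI)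
  have ss: "ss \<noteq> []" using assms by auto
  then show "\<exists>M. integral_assignment as ss \<rho> M"
    using assignment_run_exists[of ss "length as" as \<rho>] by (auto simp: integral_assignment_def)
  fix M assume "integral_assignment as ss \<rho> M"
  then obtain c where run: "assignment_run as ss \<rho> b c M"
    using assms by (auto simp: integral_assignment_def)
  show assignment: "is_assignment b m M"
    using assignment_run_is_assignment[OF run] assms by simp
  have "0 \<le> c ! i" if "i < m" for i
    using assignment_run_capacity_nonneg[OF run _ ss] assms that by simp
  then show load: "real (load as M i) \<le> \<rho> * real (ss ! i)" if "i < m" for i
    using load_le_speed[OF run] assms that by simp
  show "makespan as ss M \<le> ereal \<rho>"
    using load assms ss by (intro makespan_le) auto
  fix i assume i: "i < m" "ss ! i = 0"
  \<comment> \<open>A sum over an infinite set is 0 by default; only for finite \<open>M ! i\<close>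
    does load 0 force every bag in it to have size 0.\<close>
  have "finite (M ! i)"
    using assignment i by (auto simp: is_assignment_def intro: finite_subset)
  moreover have "load as M i = 0"
    using load[OF i(1)] i by simp
  ultimately show "\<forall>k\<in>M ! i. as ! k = 0"
    by (simp add: load_def)
qed

end
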